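(* For every finite family $\mathcal C$ of oriented cycles, $\chi(\mathrm{S\text{-}Forb}(\mathcal C))=+\infty$; that is, for every integer $N$ there is a digraph with chromatic number at least $N$ that contains no subdivision of any element of $\mathcal C$ as a subdigraph.
   Context: Digraphs are finite, without loops or parallel arcs (two opposite arcs between the same two vertices are allowed). The chromatic number $\chi(D)$ of a digraph $D$ is the chromatic number of its underlying undirected graph. The chromatic number $\chi(\mathcal D)$ of a class $\mathcal D$ of digraphs is the smallest $k$ such that $\chi(D)\le k$ for all $D\in\mathcal D$, or $+\infty$ if no such $k$ exists. An oriented cycle is an orientation of an undirected cycle. A subdivision of a digraph $F$ is obtained from $F$ by replacing each arc $uv$ by a directed $(u,v)$-path of length at least $1$, these paths being pairwise internally disjoint with new internal vertices. $\mathrm{S\text{-}Forb}(\mathcal C)$ is the class of digraphs containing no subdivision of any element of $\mathcal C$ as a subdigraph. *)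

theory Defs
  imports "Graph_Theory.Kuratowski" "HOL-Library.Extended_Nat"
begin

text \<open>
  A digraph (finite, without loops or parallel arcs, opposite arcs allowed) is a value of type
  \<^typ>\<open>'a pair_pre_digraph\<close> satisfying the library predicate \<^const>\<open>pair_digraph\<close>.
  As in the library, an undirected graph is a symmetric digraph, and \<^const>\<open>mk_symmetric\<close>
  yields the underlying undirected graph of a digraph.
\<close>

subsection \<open>Chromatic number\<close>

definition proper_colouring :: "'a pair_pre_digraph \<Rightarrow> ('a \<Rightarrow> nat) \<Rightarrow> bool" where
  "proper_colouring G c \<longleftrightarrow> (\<forall>(u, v) \<in> parcs G. c u \<noteq> c v)"

text \<open>Meaningful for finite loopless graphs, which always have a proper colouring.\<close>

definition graph_chromatic_number :: "'a pair_pre_digraph \<Rightarrow> nat" where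
  "graph_chromatic_number G = (LEAST k. \<exists>c. proper_colouring G c \<and> c ` pverts G \<subseteq> {..<k})"

definition chromatic_number :: "'a pair_pre_digraph \<Rightarrow> nat" where
  "chromatic_number D = graph_chromatic_number (mk_symmetric (with_proj D))"

definition class_chromatic_number :: "'a pair_pre_digraph set \<Rightarrow> enat" where
  "class_chromatic_number \<D> =
    (if \<exists>k. \<forall>D \<in> \<D>. chromatic_number D \<le> k
     then enat (LEAST k. \<forall>D \<in> \<D>. chromatic_number D \<le> k) else \<infinity>)"

subsection \<open>Oriented cycles\<close>

definition undirected_cycle :: "'a pair_pre_digraph \<Rightarrow> bool" where
  "undirected_cycle G \<longleftrightarrow> (\<exists>vs. distinct vs \<and> 3 \<le> length vs \<and> pverts G = set vs \<and>
    parcs G = (\<Union>i < length vs. let u = vs ! i; v = vs ! (Suc i mod length vs)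
                               in {(u, v), (v, u)}))"

definition orientation_of :: "'a pair_pre_digraph \<Rightarrow> 'a pair_pre_digraph \<Rightarrow> bool" where
  "orientation_of D G \<longleftrightarrow>
    mk_symmetric (with_proj D) = G \<and> (\<forall>u v. (u, v) \<in> parcs D \<longrightarrow> (v, u) \<notin> parcs D)"

definition oriented_cycle :: "'a pair_pre_digraph \<Rightarrow> bool" where
  "oriented_cycle D \<longleftrightarrow> (\<exists>G. undirected_cycle G \<and> orientation_of D G)"

subsection \<open>Subdivisions\<close>

text \<open>
  \<open>H\<close> is, up to renaming of vertices, a subdivision of \<open>F\<close>: the vertex \<open>u\<close> of \<open>F\<close> becomes \<open>f u\<close>,
  and the arc \<open>a\<close> of \<open>F\<close> is replaced by the directed path with list of arcs \<open>P a\<close>. The renaming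
  allows \<open>F\<close> and \<open>H\<close> to have different vertex types. (The library's \<^const>\<open>subdivision\<close> treats
  bidirected digraphs only.)
\<close>

definition directed_subdivision :: "'a pair_pre_digraph \<Rightarrow> 'b pair_pre_digraph \<Rightarrow> bool" where
  "directed_subdivision F H \<longleftrightarrow> (\<exists>(f :: 'a \<Rightarrow> 'b) (P :: 'a \<times> 'a \<Rightarrow> ('b \<times> 'b) list).
    let inner = (\<lambda>a. set (pre_digraph.inner_verts (with_proj H) (P a))) in
    inj_on f (pverts F) \<and>
    (\<forall>(u, v) \<in> parcs F.
       pre_digraph.apath (with_proj H) (f u) (P (u, v)) (f v) \<and> 1 \<le> length (P (u, v))) \<and>
    (\<forall>a \<in> parcs F. inner a \<inter> f ` pverts F = {}) \<and>
    (\<forall>a \<in> parcs F. \<forall>b \<in> parcs F. a \<noteq> b \<longrightarrow> inner a \<inter> inner b = {}) \<and>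
    pverts H = f ` pverts F \<union> (\<Union>a \<in> parcs F. inner a) \<and>
    parcs H = (\<Union>a \<in> parcs F. set (P a)))"

definition contains_subdivision :: "'b pair_pre_digraph \<Rightarrow> 'a pair_pre_digraph \<Rightarrow> bool" where
  "contains_subdivision D F \<longleftrightarrow>
    (\<exists>H. subgraph (with_proj H) (with_proj D) \<and> directed_subdivision F H)"

definition S_Forb :: "'a pair_pre_digraph set \<Rightarrow> 'b pair_pre_digraph set" where
  "S_Forb \<C> = {D. pair_digraph D \<and> (\<forall>F \<in> \<C>. \<not> contains_subdivision D F)}"

end

theory Submission
  imports Defs
begin

text \<open>
  The idea is to orient an undirected graph of large girth so that every directed path is short.
  If the colours of a proper colouring with \<open>N + 1\<close> colours increase along every arc, a directed
  path has at most \<open>N\<close> arcs, so a subdivision of an oriented cycle \<open>F\<close> in this orientation has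
  at most \<open>card (pverts F) + card (parcs F) * N\<close> vertices. Being a cycle, it has at least as many
  arcs as vertices (\<open>directed_subdivision_card\<close>). It is therefore excluded as soon as every small
  nonempty set \<open>W\<close> of vertices spans fewer than \<open>card W\<close> edges, which is the form of large girth
  used here: no cycles need to be handled, only numbers of vertices and arcs.

  The girth has to be large in terms of \<open>N\<close>, while \<open>N + 1\<close> colours must suffice. So a locally
  sparse graph that is not \<open>N\<close>-colourable is constructed first
  (\<open>exists_locally_sparse_not_colourable\<close>), and then cut down to a minimal vertex set that is not
  \<open>N\<close>-colourable; that set is \<open>N + 1\<close>-colourable, and it inherits the local sparsity.

  The sparse graph comes from the alteration method of Erdos, phrased as counting. A sequence of
  \<open>d * n\<close> pairs is drawn from the square of a set of \<open>n\<close> vertices. For a fixed \<open>d\<close> the expected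
  number of small vertex sets with too many edges is bounded independently of \<open>n\<close>
  (\<open>sum_dense_pairs_le\<close>), whereas for \<open>d\<close> large the expected number of independent sets of
  size \<open>n / (2 * r)\<close> is exponentially small in \<open>n\<close> (\<open>sum_independent_sets_le\<close>). So some sequence
  has no such independent set and fewer than \<open>n / 2\<close> dense sets; deleting one vertex from each
  dense set leaves more than \<open>n / 2\<close> vertices, too many for \<open>r\<close> colour classes.
\<close>

section \<open>Sparse graphs that are not colourable with few colours\<close>

lemma card_extensional_maps_image_subset:
  assumes "finite A" "I \<subseteq> A" "C \<subseteq> B"
  shows "card {f \<in> A \<rightarrow>\<^sub>E B. f ` I \<subseteq> C} * card B ^ card I = card C ^ card I * card B ^ card A"
proof -
  have "{f \<in> A \<rightarrow>\<^sub>E B. f ` I \<subseteq> C} = (\<Pi>\<^sub>E i\<in>A. if i \<in> I then C else B)"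
    using assms(2,3)
    by (auto simp: PiE_iff image_subset_iff extensional_def subset_iff split: if_splits)
  then have "card {f \<in> A \<rightarrow>\<^sub>E B. f ` I \<subseteq> C} = (\<Prod>i\<in>A. card (if i \<in> I then C else B))"
    using assms(1) by (simp add: card_PiE)
  also have "\<dots> = (\<Prod>i\<in>A. if i \<in> I then card C else card B)"
    by (rule prod.cong) auto
  also have "\<dots> = card C ^ card I * card B ^ card (A - I)"
    using assms(1,2) by (simp add: prod.If_cases Int_absorb1 flip: Diff_eq)
  finally have "card {f \<in> A \<rightarrow>\<^sub>E B. f ` I \<subseteq> C} * card B ^ card I
      = card C ^ card I * card B ^ (card (A - I) + card I)"
    by (simp add: power_add)
  moreover have "card (A - I) + card I = card A"
    using assms(1,2) by (metis card_Diff_subset card_mono finite_subset le_add_diff_inverse2)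
  ultimately show ?thesis by simp
qed

lemma extensional_maps_avoiding: "{f \<in> A \<rightarrow>\<^sub>E B. \<forall>i\<in>A. f i \<notin> C} = A \<rightarrow>\<^sub>E (B - C)"
  by (auto simp: PiE_iff extensional_def)

text \<open>
  A sequence \<open>f\<close> of \<open>M\<close> pairs is a multigraph on \<open>{..<n}\<close>. A set \<open>W\<close> of \<open>k\<close> vertices spanning at
  least \<open>k\<close> of the pairs is counted once for every choice of the positions \<open>I\<close> of \<open>k\<close> such pairs:
  for a fixed \<open>(W, I)\<close> the sequences \<open>f\<close> are easy to count.
\<close>

definition dense_pairs :: "nat \<Rightarrow> nat \<Rightarrow> nat \<Rightarrow> (nat \<Rightarrow> nat \<times> nat) \<Rightarrow> (nat set \<times> nat set) set" where
  "dense_pairs n M k f = {p \<in> {W. W \<subseteq> {..<n} \<and> card W = k} \<times> {I. I \<subseteq> {..<M} \<and> card I = k}.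
     f ` snd p \<subseteq> fst p \<times> fst p}"

definition independent_sets :: "nat \<Rightarrow> nat \<Rightarrow> nat \<Rightarrow> (nat \<Rightarrow> nat \<times> nat) \<Rightarrow> nat set set" where
  "independent_sets n M m f = {S \<in> {S. S \<subseteq> {..<n} \<and> card S = m}. \<forall>i\<in>{..<M}. f i \<notin> S \<times> S}"

lemma finite_dense_pairs: "finite (dense_pairs n M k f)"
  unfolding dense_pairs_def by (rule finite_subset[of _ "Pow {..<n} \<times> Pow {..<M}"]) auto

lemma finite_independent_sets: "finite (independent_sets n M m f)"
  unfolding independent_sets_def by (rule finite_subset[of _ "Pow {..<n}"]) auto

lemma choose_le_pow: "n choose k \<le> n ^ k"
  by (cases "k \<le> n") (auto simp: binomial_le_pow binomial_eq_0)

text \<open>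
  There are at most \<open>n ^ k * (d * n) ^ k\<close> pairs \<open>(W, I)\<close>, and each belongs to a fraction
  \<open>(k\<^sup>2 / n\<^sup>2) ^ k\<close> of all sequences. The powers of \<open>n\<close> cancel.
\<close>

lemma sum_dense_pairs_le:
  fixes n d k :: nat
  defines "\<Omega> \<equiv> {..<d * n} \<rightarrow>\<^sub>E {..<n} \<times> {..<n}"
  assumes "n > 0"
  shows "(\<Sum>f\<in>\<Omega>. card (dense_pairs n (d * n) k f)) \<le> (d * k\<^sup>2) ^ k * card \<Omega>"
proof -
  define P where "P = {W. W \<subseteq> {..<n} \<and> card W = k} \<times> {I. I \<subseteq> {..<d * n} \<and> card I = k}"
  have fin: "finite \<Omega>" "finite P"
    unfolding \<Omega>_def P_def by (auto intro: finite_PiE)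
  have card\<Omega>: "card \<Omega> = (n\<^sup>2) ^ (d * n)"
    by (simp add: \<Omega>_def card_PiE card_cartesian_product power2_eq_square)
  have cardP: "card P = (n choose k) * (d * n choose k)"
    by (simp add: P_def card_cartesian_product n_subsets)
  have each: "card {f \<in> \<Omega>. f ` snd p \<subseteq> fst p \<times> fst p} * (n\<^sup>2) ^ k = (k\<^sup>2) ^ k * card \<Omega>"
    if p: "p \<in> P" for p
  proof -
    have "snd p \<subseteq> {..<d * n}" "fst p \<times> fst p \<subseteq> {..<n} \<times> {..<n}" "card (fst p) = k" "card (snd p) = k"
      using p by (auto simp: P_def)
    then show ?thesis
      using card_extensional_maps_image_subset[of "{..<d * n}" "snd p" "fst p \<times> fst p" "{..<n} \<times> {..<n}"]
      unfolding card\<Omega> by (simp add: \<Omega>_def card_cartesian_product power2_eq_square)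
  qed
  have "(\<Sum>f\<in>\<Omega>. card (dense_pairs n (d * n) k f))
      = (\<Sum>p\<in>P. card {f \<in> \<Omega>. f ` snd p \<subseteq> fst p \<times> fst p})"
    unfolding dense_pairs_def P_def[symmetric] using fin by (intro sum_multicount_gen) auto
  then have "(\<Sum>f\<in>\<Omega>. card (dense_pairs n (d * n) k f)) * (n\<^sup>2) ^ k
      = (\<Sum>p\<in>P. (k\<^sup>2) ^ k * card \<Omega>)"
    using each by (simp add: sum_distrib_right)
  also have "\<dots> = card P * ((k\<^sup>2) ^ k * card \<Omega>)" by simp
  also have "\<dots> \<le> (n ^ k * (d * n) ^ k) * ((k\<^sup>2) ^ k * card \<Omega>)"
    unfolding cardP by (intro mult_right_mono mult_mono choose_le_pow) auto
  also have "\<dots> = ((d * k\<^sup>2) ^ k * card \<Omega>) * (n\<^sup>2) ^ k"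
    by (simp add: power_mult_distrib power2_eq_square ac_simps)
  finally show ?thesis using \<open>n > 0\<close> by simp
qed

lemma sum_independent_sets_le:
  fixes n M m :: nat
  defines "\<Omega> \<equiv> {..<M} \<rightarrow>\<^sub>E {..<n} \<times> {..<n}"
  shows "(\<Sum>f\<in>\<Omega>. card (independent_sets n M m f)) \<le> 2 ^ n * (n\<^sup>2 - m\<^sup>2) ^ M"
proof -
  define P where "P = {S. S \<subseteq> {..<n} \<and> card S = m}"
  have fin: "finite \<Omega>" "finite P"
    unfolding \<Omega>_def P_def by (auto intro: finite_PiE)
  have each: "card {f \<in> \<Omega>. \<forall>i\<in>{..<M}. f i \<notin> S \<times> S} = (n\<^sup>2 - m\<^sup>2) ^ M" if "S \<in> P" for S
  proof -
    have "{f \<in> \<Omega>. \<forall>i\<in>{..<M}. f i \<notin> S \<times> S} = ({..<M} \<rightarrow>\<^sub>E ({..<n} \<times> {..<n} - S \<times> S))"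
      unfolding \<Omega>_def by (rule extensional_maps_avoiding)
    moreover have "card ({..<n} \<times> {..<n} - S \<times> S) = n\<^sup>2 - m\<^sup>2"
    proof -
      have "S \<times> S \<subseteq> {..<n} \<times> {..<n}" "card S = m" using that by (auto simp: P_def)
      moreover have "finite (S \<times> S)"
        using that finite_subset[of S "{..<n}"] by (auto simp: P_def)
      ultimately show ?thesis
        by (simp add: card_Diff_subset card_cartesian_product power2_eq_square)
    qed
    ultimately show ?thesis by (simp add: card_PiE)
  qed
  have "(\<Sum>f\<in>\<Omega>. card (independent_sets n M m f)) = (\<Sum>S\<in>P. (n\<^sup>2 - m\<^sup>2) ^ M)"
    unfolding independent_sets_def P_def[symmetric]
    using fin each by (intro sum_multicount_gen) auto
  also have "\<dots> = (n choose m) * (n\<^sup>2 - m\<^sup>2) ^ M" by (simp add: P_def n_subsets)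
  also have "\<dots> \<le> 2 ^ n * (n\<^sup>2 - m\<^sup>2) ^ M" by (simp add: binomial_le_pow2)
  finally show ?thesis .
qed

text \<open>
  An averaging argument for the weight \<open>X f + r * m * Y f\<close>, where \<open>X\<close> counts the dense pairs and
  \<open>Y\<close> the independent sets: a sequence of weight less than \<open>r * m\<close> has \<open>Y f = 0\<close> and
  \<open>X f < r * m\<close>, half the number of vertices.
\<close>

lemma exists_few_dense_no_independent:
  fixes r L :: nat
  assumes "r > 0"
  obtains m M f where "m > 0" "f \<in> {..<M} \<rightarrow>\<^sub>E {..<2 * r * m} \<times> {..<2 * r * m}"
    "independent_sets (2 * r * m) M m f = {}"
    "(\<Sum>k=1..L. card (dense_pairs (2 * r * m) M k f)) < r * m"
proof -
  \<comment> \<open>\<open>q\<close> is the probability that a random pair avoids \<open>S \<times> S\<close>, where \<open>S\<close> has size \<open>m = n / (2 * r)\<close>.\<close>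
  define q where "q = 1 - 1 / (2 * real r)\<^sup>2"
  have "1 \<le> (2 * real r)\<^sup>2" using assms by (intro one_le_power) auto
  then have q: "0 \<le> q" "q < 1" using assms by (auto simp: q_def divide_simps)
  \<comment> \<open>The at most \<open>2 ^ n\<close> sets \<open>S\<close> then contribute at most \<open>(2 * q ^ d) ^ n \<le> 1 / 2\<close>.\<close>
  then obtain d where d: "q ^ d < 1 / 4" using real_arch_pow_inv[of "1/4" q] by auto
  define K where "K = (\<Sum>k=1..L. (d * k\<^sup>2) ^ k)"
  \<comment> \<open>The average of \<open>X\<close> is at most \<open>K\<close>, which has to be less than \<open>r * m / 2\<close>.\<close>
  define m where "m = 2 * K + 1"
  define n where "n = 2 * r * m"
  define \<Omega> where "\<Omega> = ({..<d * n} \<rightarrow>\<^sub>E {..<n} \<times> {..<n})"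
  define X where "X = (\<lambda>f. \<Sum>k=1..L. card (dense_pairs n (d * n) k f))"
  define Y where "Y = (\<lambda>f. card (independent_sets n (d * n) m f))"
  have "m > 0" "n > 0" using assms by (auto simp: m_def n_def)
  have "card \<Omega> = (n\<^sup>2) ^ (d * n)"
    by (simp add: \<Omega>_def card_PiE card_cartesian_product power2_eq_square)
  then have card\<Omega>: "real (card \<Omega>) = ((real n)\<^sup>2) ^ (d * n)" by simp
  have pos: "card \<Omega> > 0" using \<open>n > 0\<close> \<open>card \<Omega> = _\<close> by simp
  have X: "(\<Sum>f\<in>\<Omega>. X f) \<le> K * card \<Omega>"
  proof -
    have "(\<Sum>f\<in>\<Omega>. X f) = (\<Sum>k=1..L. \<Sum>f\<in>\<Omega>. card (dense_pairs n (d * n) k f))"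
      unfolding X_def by (rule sum.swap)
    also have "\<dots> \<le> (\<Sum>k=1..L. (d * k\<^sup>2) ^ k * card \<Omega>)"
      unfolding \<Omega>_def by (intro sum_mono sum_dense_pairs_le \<open>n > 0\<close>)
    finally show ?thesis by (simp add: K_def sum_distrib_right)
  qed
  have Y: "real (\<Sum>f\<in>\<Omega>. Y f) \<le> card \<Omega> / 2"
  proof -
    have mn: "m\<^sup>2 \<le> n\<^sup>2" using assms by (intro power_mono) (auto simp: n_def)
    have eq: "real (n\<^sup>2 - m\<^sup>2) = (real n)\<^sup>2 * q"
      using mn assms \<open>m > 0\<close> by (simp add: of_nat_diff q_def n_def field_simps power2_eq_square)
    have "real (\<Sum>f\<in>\<Omega>. Y f) \<le> real (2 ^ n * (n\<^sup>2 - m\<^sup>2) ^ (d * n))"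
      using sum_independent_sets_le[of n "d * n" m] unfolding Y_def \<Omega>_def of_nat_le_iff .
    also have "\<dots> = 2 ^ n * (real (n\<^sup>2 - m\<^sup>2)) ^ (d * n)" by simp
    also have "\<dots> = (2 * q ^ d) ^ n * card \<Omega>"
      unfolding eq card\<Omega> power_mult_distrib power_mult[of q d n, symmetric] by simp
    also have "\<dots> \<le> (1 / 2) ^ n * card \<Omega>"
      using d q by (intro mult_right_mono power_mono) auto
    also have "\<dots> \<le> (1 / 2) ^ 1 * card \<Omega>"
      using \<open>n > 0\<close> by (intro mult_right_mono power_decreasing) auto
    finally show ?thesis by simp
  qed
  have "\<exists>f\<in>\<Omega>. X f + r * m * Y f < r * m"
  proof (rule ccontr)
    assume "\<not> ?thesis"
    then have "(\<Sum>f\<in>\<Omega>. r * m) \<le> (\<Sum>f\<in>\<Omega>. X f + r * m * Y f)" by (intro sum_mono) auto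
    then have "card \<Omega> * (r * m) \<le> (\<Sum>f\<in>\<Omega>. X f) + r * m * (\<Sum>f\<in>\<Omega>. Y f)"
      by (simp add: sum.distrib sum_distrib_left)
    also have "\<dots> \<le> K * card \<Omega> + r * m * (\<Sum>f\<in>\<Omega>. Y f)" using X by simp
    finally have "real (card \<Omega> * (r * m)) \<le> real (K * card \<Omega> + r * m * (\<Sum>f\<in>\<Omega>. Y f))"
      by (simp only: of_nat_le_iff)
    also have "\<dots> = K * card \<Omega> + real (r * m) * real (\<Sum>f\<in>\<Omega>. Y f)" by simp
    also have "\<dots> \<le> K * card \<Omega> + real (r * m) * (card \<Omega> / 2)"
      using Y by (intro add_left_mono mult_left_mono) auto
    finally have "real (card \<Omega>) * real (r * m) \<le> real (card \<Omega>) * (K + real (r * m) / 2)"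
      by (simp add: algebra_simps)
    then have "real (r * m) \<le> real (2 * K)" using pos by simp
    then have "r * m \<le> 2 * K" by (simp only: of_nat_le_iff)
    moreover have "m \<le> r * m" using assms by simp
    ultimately show False by (simp add: m_def)
  qed
  then obtain f where f: "f \<in> \<Omega>" "X f + r * m * Y f < r * m" by blast
  then have "Y f = 0" by (cases "Y f") auto
  then have "independent_sets n (d * n) m f = {}"
    using finite_independent_sets by (simp add: Y_def)
  then show thesis using that[of m f "d * n"] f \<open>m > 0\<close> unfolding X_def \<Omega>_def n_def by simp
qed

definition colourable :: "(nat \<times> nat) set \<Rightarrow> nat \<Rightarrow> nat set \<Rightarrow> bool" where
  "colourable E r U \<longleftrightarrow> (\<exists>c. c ` U \<subseteq> {..<r} \<and> (\<forall>(u, v) \<in> E \<inter> U \<times> U. c u \<noteq> c v))"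

lemma colourableE:
  assumes "colourable E r U"
  obtains c where "c ` U \<subseteq> {..<r}"
    "\<And>u v. (u, v) \<in> E \<Longrightarrow> u \<in> U \<Longrightarrow> v \<in> U \<Longrightarrow> c u \<noteq> c v"
  using assms unfolding colourable_def by blast

text \<open>
  For \<open>L \<ge> 1\<close> this forbids loops, since singletons span no edge. For a loopless set of pairs
  without opposite pairs it says that every subgraph with at most \<open>L\<close> vertices is a forest.
\<close>

definition locally_sparse :: "(nat \<times> nat) set \<Rightarrow> nat \<Rightarrow> nat set \<Rightarrow> bool" where
  "locally_sparse E L U \<longleftrightarrow>
     (\<forall>W \<subseteq> U. W \<noteq> {} \<longrightarrow> card W \<le> L \<longrightarrow> card (E \<inter> W \<times> W) < card W)"

lemma exists_locally_sparse_not_colourable: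
  fixes r L :: nat
  obtains E U where "finite E" "finite U" "locally_sparse E L U" "\<not> colourable E r U"
proof (cases "r = 0")
  case True
  then have "\<not> colourable {} r {0}" by (auto simp: colourable_def)
  moreover have "locally_sparse {} L {0}"
    by (auto simp: locally_sparse_def card_gt_0_iff intro: finite_subset)
  ultimately show thesis using that[of "{}" "{0}"] by simp
next
  case False
  then have "r > 0" by simp
  then obtain m M f where m: "m > 0"
    and f: "f \<in> {..<M} \<rightarrow>\<^sub>E {..<2 * r * m} \<times> {..<2 * r * m}"
    and ind: "independent_sets (2 * r * m) M m f = {}"
    and few: "(\<Sum>k=1..L. card (dense_pairs (2 * r * m) M k f)) < r * m"
    by (rule exists_few_dense_no_independent)
  define n where "n = 2 * r * m"
  \<comment> \<open>One vertex is deleted from each dense set.\<close>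
  define B where "B = (\<lambda>p. SOME x. x \<in> fst p) ` (\<Union>k\<in>{1..L}. dense_pairs n M k f)"
  define U where "U = {..<n} - B"
  have "card B \<le> card (\<Union>k\<in>{1..L}. dense_pairs n M k f)"
    unfolding B_def by (rule card_image_le) (simp add: finite_dense_pairs)
  also have "\<dots> \<le> (\<Sum>k=1..L. card (dense_pairs n M k f))" by (rule card_UN_le) simp
  finally have "card B < r * m" using few by (simp add: n_def)
  moreover have "n - card B \<le> card U"
    unfolding U_def using diff_card_le_card_Diff[of B "{..<n}"]
    by (simp add: B_def finite_dense_pairs)
  ultimately have cardU: "r * m < card U" by (simp add: n_def)
  have "locally_sparse (f ` {..<M}) L U"
    unfolding locally_sparse_def
  proof (intro allI impI, rule ccontr)
    fix W assume W: "W \<subseteq> U" "W \<noteq> {}" "card W \<le> L"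
      and "\<not> card (f ` {..<M} \<inter> W \<times> W) < card W"
    then obtain E' where E': "E' \<subseteq> f ` {..<M} \<inter> W \<times> W" "card E' = card W"
      by (meson not_less obtain_subset_with_card_n)
    then obtain I where I: "I \<subseteq> {..<M}" "inj_on f I" "E' = f ` I"
      using subset_image_inj[of E' f "{..<M}"] by auto
    have "finite W" "W \<subseteq> {..<n}" using W(1) finite_subset by (auto simp: U_def)
    then have "card W \<in> {1..L}" using W by (simp add: Suc_le_eq card_gt_0_iff)
    moreover have "(W, I) \<in> dense_pairs n M (card W) f"
      using I E' \<open>W \<subseteq> {..<n}\<close> by (auto simp: dense_pairs_def card_image)
    ultimately have "(W, I) \<in> (\<Union>k\<in>{1..L}. dense_pairs n M k f)" by blast
    then have "(SOME x. x \<in> W) \<in> B"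
      unfolding B_def by (rule rev_image_eqI) simp
    moreover have "(SOME x. x \<in> W) \<in> W" using W(2) by (simp add: some_in_eq)
    ultimately show False using W(1) by (auto simp: U_def)
  qed
  moreover have "\<not> colourable (f ` {..<M}) r U"
  proof
    assume "colourable (f ` {..<M}) r U"
    then obtain c where c: "c ` U \<subseteq> {..<r}"
      and proper: "\<And>u v. (u, v) \<in> f ` {..<M} \<Longrightarrow> u \<in> U \<Longrightarrow> v \<in> U \<Longrightarrow> c u \<noteq> c v"
      by (rule colourableE) (rule that; simp)
    have "\<exists>j<r. m \<le> card {x \<in> U. c x = j}"
    proof (rule ccontr)
      assume small: "\<not> ?thesis"
      have "U = (\<Union>j\<in>{..<r}. {x \<in> U. c x = j})" using c by auto
      then have "card U \<le> (\<Sum>j<r. card {x \<in> U. c x = j})"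
        using card_UN_le[of "{..<r}" "\<lambda>j. {x \<in> U. c x = j}"] by simp
      also have "\<dots> \<le> (\<Sum>j<r. m)" using small by (intro sum_mono) (auto simp: not_le less_imp_le)
      finally show False using cardU by simp
    qed
    then obtain j S where S: "S \<subseteq> {x \<in> U. c x = j}" "card S = m"
      by (meson obtain_subset_with_card_n)
    have "S \<notin> independent_sets n M m f" using ind by (simp add: n_def)
    then obtain i where "i < M" "f i \<in> S \<times> S"
      using S by (auto simp: independent_sets_def U_def)
    moreover from this have "f i \<in> f ` {..<M}" by blast
    ultimately show False using proper S(1) by (cases "f i") auto
  qed
  ultimately show thesis using that[of "f ` {..<M}" U] by (simp add: U_def)
qed

text \<open>
  Removing one vertex \<open>w\<close> from an inclusion-minimal \<open>W\<close> makes it \<open>r\<close>-colourable, and \<open>w\<close> can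
  receive a new colour.
\<close>

lemma minimal_not_colourable:
  assumes "finite U" "\<not> colourable E r U" "\<And>v. v \<in> U \<Longrightarrow> (v, v) \<notin> E"
  obtains W where "W \<subseteq> U" "\<not> colourable E r W" "colourable E (Suc r) W"
proof -
  let ?A = "{W. W \<subseteq> U \<and> \<not> colourable E r W}"
  have "finite ?A" "?A \<noteq> {}" using assms by auto
  from finite_has_minimal[OF this] obtain W where W: "W \<subseteq> U" "\<not> colourable E r W"
    and W': "\<And>W'. W' \<in> ?A \<Longrightarrow> W' \<subseteq> W \<Longrightarrow> W = W'"
    by (elim bexE CollectE conjE) metis
  have min: "colourable E r W'" if "W' \<subset> W" for W'
    using W'[of W'] W(1) that by blast
  have "W \<noteq> {}" using W(2) by (auto simp: colourable_def)
  then obtain w where "w \<in> W" by blast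
  then have "colourable E r (W - {w})" by (intro min) auto
  then obtain c where c: "c ` (W - {w}) \<subseteq> {..<r}"
    "\<And>u v. (u, v) \<in> E \<Longrightarrow> u \<in> W - {w} \<Longrightarrow> v \<in> W - {w} \<Longrightarrow> c u \<noteq> c v"
    by (rule colourableE) (rule that; simp)
  have less: "c x < r" if "x \<in> W" "x \<noteq> w" for x using c(1) that by auto
  then have "(c(w := r)) ` W \<subseteq> {..<Suc r}" by (auto simp: less_Suc_eq)
  moreover have "(c(w := r)) u \<noteq> (c(w := r)) v" if uv: "(u, v) \<in> E" "u \<in> W" "v \<in> W" for u v
  proof -
    consider "u = w" "v \<noteq> w" | "u \<noteq> w" "v = w" | "u \<in> W - {w}" "v \<in> W - {w}"
      using uv assms(3) W(1) \<open>w \<in> W\<close> by blast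
    then show ?thesis
    proof cases
      case 1
      then show ?thesis using less[of v] uv by simp
    next
      case 2
      then show ?thesis using less[of u] uv by simp
    next
      case 3
      then show ?thesis using c(2)[OF uv(1)] by simp
    qed
  qed
  ultimately have "colourable E (Suc r) W" unfolding colourable_def by blast
  then show thesis using that W by blast
qed

section \<open>Subdivisions of oriented cycles\<close>

lemma pcas_path_verts:
  assumes "pcas u p v" "p \<noteq> []"
  shows "pawalk_verts u p = map fst p @ [v]" "map fst p = u # tl (map fst p)"
    "map snd p = tl (map fst p) @ [v]"
proof -
  have "pawalk_verts u p = map fst p @ [v] \<and> u # map snd p = map fst p @ [v]"
    using assms(1) by (induction u p v rule: pcas.induct) auto
  then show "pawalk_verts u p = map fst p @ [v]" "map fst p = u # tl (map fst p)"
    "map snd p = tl (map fst p) @ [v]"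
    using assms(2) by (cases p; auto)+
qed

text \<open>This bounds the length of a path by the number of colours when \<open>c\<close> increases along arcs.\<close>

lemma pcas_increasing_length:
  assumes "pcas u p v" "\<And>x y. (x, y) \<in> set p \<Longrightarrow> (c x :: nat) < c y"
  shows "c u + length p \<le> c v"
  using assms by (induction u p v rule: pcas.induct) fastforce+

text \<open>
  Of an oriented cycle only the number of arcs matters below. Each edge \<open>{vs ! i, vs ! (i + 1)}\<close>
  yields an arc \<open>e i\<close>, and distinct edges yield distinct arcs because there are at least three
  vertices on the cycle.
\<close>

lemma oriented_cycle_facts:
  assumes "oriented_cycle F"
  shows "finite (pverts F)" "pverts F \<noteq> {}" "parcs F \<subseteq> pverts F \<times> pverts F"
    "card (pverts F) \<le> card (parcs F)"
proof -
  obtain vs where vs: "distinct vs" "3 \<le> length vs" "pverts F = set vs"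
    and arcs: "(\<Union>e\<in>parcs F. {(fst e, snd e), (snd e, fst e)})
      = (\<Union>i < length vs. {(vs ! i, vs ! (Suc i mod length vs)), (vs ! (Suc i mod length vs), vs ! i)})"
    using assms by (auto simp: oriented_cycle_def undirected_cycle_def orientation_of_def Let_def
        parcs_mk_symmetric dest!: arg_cong[of _ _ pverts])
  let ?n = "length vs"
  let ?s = "\<lambda>i. Suc i mod ?n"
  have n: "?s i < ?n" for i using vs(2) by (intro mod_less_divisor) auto
  show "finite (pverts F)" "pverts F \<noteq> {}" using vs by auto
  show sub: "parcs F \<subseteq> pverts F \<times> pverts F"
  proof
    fix e assume "e \<in> parcs F"
    then have "e \<in> (\<Union>e\<in>parcs F. {(fst e, snd e), (snd e, fst e)})" by force
    then show "e \<in> pverts F \<times> pverts F" unfolding arcs vs(3) using n by auto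
  qed
  have fin: "finite (parcs F)" using sub vs(3) by (metis finite_SigmaI finite_set finite_subset)
  have "\<exists>e\<in>parcs F. e = (vs ! i, vs ! ?s i) \<or> e = (vs ! ?s i, vs ! i)" if "i < ?n" for i
  proof -
    have "(vs ! i, vs ! ?s i) \<in> (\<Union>e\<in>parcs F. {(fst e, snd e), (snd e, fst e)})"
      unfolding arcs using that by auto
    then show ?thesis by auto
  qed
  then obtain e where e: "\<And>i. i < ?n \<Longrightarrow> e i \<in> parcs F \<and>
      (e i = (vs ! i, vs ! ?s i) \<or> e i = (vs ! ?s i, vs ! i))"
    by metis
  have "inj_on e {..<?n}"
  proof (rule inj_onI, rule ccontr)
    fix i j assume ij: "i \<in> {..<?n}" "j \<in> {..<?n}" "e i = e j" "i \<noteq> j"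
    then have "vs ! i = vs ! ?s j" "vs ! ?s i = vs ! j"
      using e[of i] e[of j] nth_eq_iff_index_eq[OF vs(1), of i j] by auto
    then have "i = ?s j" "j = ?s i"
      using ij n nth_eq_iff_index_eq[OF vs(1)] by auto
    \<comment> \<open>Two steps of the cyclic successor lead from \<open>i\<close> back to \<open>i\<close>, so the length would be at most 2.\<close>
    moreover have "?s k = (if Suc k = ?n then 0 else Suc k)" if "k < ?n" for k
      using that by (simp add: mod_Suc)
    ultimately show False using vs(2) ij(1,2) by (auto split: if_splits)
  qed
  moreover have "e ` {..<?n} \<subseteq> parcs F" using e by auto
  ultimately have "card {..<?n} \<le> card (parcs F)" using fin by (rule card_inj_on_le)
  then show "card (pverts F) \<le> card (parcs F)" using vs by (simp add: distinct_card)
qed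

text \<open>
  Replacing an arc by a path adds as many arcs as inner vertices, so \<open>H\<close> inherits from \<open>F\<close> that
  it has at least as many arcs as vertices; here the arc sets of different paths must be shown
  disjoint. A function \<open>c\<close> with values at most \<open>N\<close> that increases along the arcs of \<open>H\<close> leaves
  room for fewer than \<open>N\<close> inner vertices on each path.
\<close>

lemma directed_subdivision_card:
  assumes sub: "directed_subdivision F H"
    and fin: "finite (pverts F)" and wf: "parcs F \<subseteq> pverts F \<times> pverts F"
    and ge: "card (pverts F) \<le> card (parcs F)"
    and incr: "\<And>x y. (x, y) \<in> parcs H \<Longrightarrow> (c x :: nat) < c y \<and> c y \<le> N"
  shows "card (pverts H) \<le> card (parcs H)"
    "card (pverts H) \<le> card (pverts F) + card (parcs F) * N"
proof -
  obtain f :: "'a \<Rightarrow> 'b" and P :: "'a \<times> 'a \<Rightarrow> ('b \<times> 'b) list"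
    where inj: "inj_on f (pverts F)"
    and P: "\<forall>(u, v) \<in> parcs F.
      pre_digraph.apath (with_proj H) (f u) (P (u, v)) (f v) \<and> 1 \<le> length (P (u, v))"
    and in1: "\<forall>a \<in> parcs F. set (tl (map fst (P a))) \<inter> f ` pverts F = {}"
    and in2: "\<forall>a \<in> parcs F. \<forall>b \<in> parcs F. a \<noteq> b \<longrightarrow>
      set (tl (map fst (P a))) \<inter> set (tl (map fst (P b))) = {}"
    and H: "pverts H = f ` pverts F \<union> (\<Union>a \<in> parcs F. set (tl (map fst (P a))))"
      "parcs H = (\<Union>a \<in> parcs F. set (P a))"
    using sub unfolding directed_subdivision_def Let_def inner_verts_with_proj_def
    by (elim exE conjE) (rule that)
  have path: "pre_digraph.apath (with_proj H) (f u) (P (u, v)) (f v)" "P (u, v) \<noteq> []"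
    if "(u, v) \<in> parcs F" for u v
    using bspec[OF P that] by auto
  note inner = bspec[OF in1] bspec[OF bspec[OF in2], THEN mp]
  have finA: "finite (parcs F)" using wf fin by (meson finite_SigmaI finite_subset)
  define In where "In a = set (tl (map fst (P a)))" for a
  have walk: "pcas (f u) (P (u, v)) (f v)" "distinct (pawalk_verts (f u) (P (u, v)))"
    if "(u, v) \<in> parcs F" for u v
    using path(1)[OF that] by (auto simp: pre_digraph.apath_def pre_digraph.awalk_def
        cas_with_proj_eq awalk_verts_with_proj_eq)
  have verts: "fst ` set (P (u, v)) = insert (f u) (In (u, v))"
    "snd ` set (P (u, v)) = insert (f v) (In (u, v))"
    "card (set (P (u, v))) = Suc (card (In (u, v)))" "card (In (u, v)) \<le> N"
    if a: "(u, v) \<in> parcs F" for u v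
  proof -
    note p = pcas_path_verts[OF walk(1)[OF a] path(2)[OF a]]
    have d: "distinct (map fst (P (u, v)))" using walk(2)[OF a] p(1) by simp
    show "fst ` set (P (u, v)) = insert (f u) (In (u, v))"
      using arg_cong[OF p(2), of set] by (simp add: In_def)
    show "snd ` set (P (u, v)) = insert (f v) (In (u, v))"
      using arg_cong[OF p(3), of set] by (simp add: In_def)
    have In: "card (In (u, v)) = length (P (u, v)) - 1"
      unfolding In_def using d by (simp add: distinct_card distinct_tl)
    moreover have "card (set (P (u, v))) = length (P (u, v))"
      using d by (simp add: distinct_card distinct_map)
    ultimately show "card (set (P (u, v))) = Suc (card (In (u, v)))"
      using path(2)[OF a] by (cases "P (u, v)") auto
    have set: "set (P (u, v)) \<subseteq> parcs H" using a H(2) by blast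
    have "c (f u) + length (P (u, v)) \<le> c (f v)"
      using pcas_increasing_length[OF walk(1)[OF a], of c] incr set by blast
    moreover have "c (f v) \<le> N"
    proof -
      have "f v \<in> snd ` set (P (u, v))" using arg_cong[OF p(3), of set] by simp
      then show ?thesis using incr set by force
    qed
    ultimately show "card (In (u, v)) \<le> N" using In by simp
  qed
  \<comment> \<open>A common arc of two paths has no inner vertex as an end, so it joins the ends of both paths,
    and then both replace the same arc of \<open>F\<close>.\<close>
  have disj: "set (P a) \<inter> set (P b) = {}" if ab: "a \<in> parcs F" "b \<in> parcs F" "a \<noteq> b" for a b
  proof (rule ccontr)
    assume "set (P a) \<inter> set (P b) \<noteq> {}"
    then obtain e where e: "e \<in> set (P a)" "e \<in> set (P b)" by blast
    obtain u v u' v' where uv: "a = (u, v)" "b = (u', v')" by (cases a, cases b)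
    have V: "u \<in> pverts F" "v \<in> pverts F" "u' \<in> pverts F" "v' \<in> pverts F"
      using ab wf uv by auto
    have ends: "fst e \<in> insert (f u) (In a) \<inter> insert (f u') (In b)"
      "snd e \<in> insert (f v) (In a) \<inter> insert (f v') (In b)"
      using e verts(1,2)[of u v] verts(1,2)[of u' v'] ab unfolding uv by blast+
    have eq: "x = y"
      if "z \<in> insert x (In a) \<inter> insert y (In b)" "x \<in> f ` pverts F" "y \<in> f ` pverts F" for x y z
    proof -
      have "In a \<inter> f ` pverts F = {}" "In b \<inter> f ` pverts F = {}" "In a \<inter> In b = {}"
        using inner(1)[OF ab(1)] inner(1)[OF ab(2)] inner(2)[OF ab] by (simp_all only: In_def)
      then show ?thesis using that by auto
    qed
    have "f u = f u'" "f v = f v'"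
      using eq[OF ends(1) imageI imageI] eq[OF ends(2) imageI imageI] V by blast+
    then have "u = u'" "v = v'" using inj V unfolding inj_on_def by blast+
    then show False using ab uv by simp
  qed
  have "card (pverts H) \<le> card (f ` pverts F) + card (\<Union>a \<in> parcs F. In a)"
    unfolding H(1) In_def by (rule card_Un_le)
  also have "\<dots> \<le> card (pverts F) + (\<Sum>a \<in> parcs F. card (In a))"
    using fin finA by (intro add_mono card_image_le card_UN_le)
  finally have le: "card (pverts H) \<le> card (pverts F) + (\<Sum>a \<in> parcs F. card (In a))" .
  also have "\<dots> \<le> (\<Sum>a \<in> parcs F. Suc (card (In a)))" using ge by (simp add: sum_Suc)
  also have "\<dots> = (\<Sum>a \<in> parcs F. card (set (P a)))"
    using verts(3) by (intro sum.cong) auto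
  also have "\<dots> = card (parcs H)"
    unfolding H(2) using finA disj by (intro card_UN_disjoint[symmetric]) auto
  finally show "card (pverts H) \<le> card (parcs H)" .
  have "(\<Sum>a \<in> parcs F. card (In a)) \<le> card (parcs F) * N"
    using verts(4) sum_bounded_above[of "parcs F" "\<lambda>a. card (In a)" N] by auto
  then show "card (pverts H) \<le> card (pverts F) + card (parcs F) * N" using le by simp
qed

section \<open>Orienting along a colouring\<close>

text \<open>
  The chromatic number is a least element, so this needs some proper colouring to exist; an
  injective one does, as there are no loops.
\<close>

lemma chromatic_number_colouring:
  assumes "pair_digraph D"
  obtains c where "c ` pverts D \<subseteq> {..<chromatic_number D}"
    "\<And>u v. (u, v) \<in> parcs D \<Longrightarrow> c u \<noteq> c v"
proof -
  interpret pair_digraph D by fact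
  let ?col = "\<lambda>k. \<exists>c. proper_colouring (mk_symmetric (with_proj D)) c \<and>
      c ` pverts (mk_symmetric (with_proj D)) \<subseteq> {..<k}"
  obtain c :: "'a \<Rightarrow> nat" and k where c: "c ` pverts D = {..<k}" "inj_on c (pverts D)"
    using finite_imp_inj_to_nat_seg[OF pair_finite_verts] by (auto simp: lessThan_def)
  have "c u \<noteq> c v" if "(u, v) \<in> parcs D" for u v
    using that c(2) arc_fst_in_verts arc_snd_in_verts pair_no_loops
    by (metis fst_conv inj_onD snd_conv)
  then have "?col k"
    using c(1) by (intro exI[of _ c]) (fastforce simp: proper_colouring_def parcs_mk_symmetric)
  then have "?col (chromatic_number D)"
    unfolding chromatic_number_def graph_chromatic_number_def by (rule LeastI)
  then show thesis
    using that by (fastforce simp: proper_colouring_def parcs_mk_symmetric)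
qed

text \<open>
  The arcs of \<open>D\<close> go from smaller to larger colour, so a subdivision \<open>H\<close> of \<open>F\<close> in \<open>D\<close> has at most
  \<open>L\<close> vertices, and its vertex set contradicts the local sparsity.
\<close>

lemma exists_subdivision_free:
  fixes \<C> :: "'a pair_pre_digraph set" and N :: nat
  assumes "finite \<C>" "\<forall>F \<in> \<C>. oriented_cycle F"
  shows "\<exists>D :: nat pair_pre_digraph.
    pair_digraph D \<and> N < chromatic_number D \<and> (\<forall>F \<in> \<C>. \<not> contains_subdivision D F)"
proof -
  \<comment> \<open>\<open>L\<close> bounds the size of all subdivisions in question, and it is positive to exclude loops.\<close>
  define L where "L = Suc (\<Sum>F\<in>\<C>. card (pverts F) + card (parcs F) * N)"
  obtain E U where EU: "finite E" "finite U" "locally_sparse E L U" "\<not> colourable E N U"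
    by (rule exists_locally_sparse_not_colourable)
  have loopfree: "(v, v) \<notin> E" if "v \<in> U" for v
  proof
    assume "(v, v) \<in> E"
    then have "E \<inter> {v} \<times> {v} = {(v, v)}" by auto
    moreover have "card (E \<inter> {v} \<times> {v}) < card {v}"
      using EU(3) that unfolding locally_sparse_def by (auto simp: L_def)
    ultimately show False by simp
  qed
  obtain W where W: "W \<subseteq> U" "\<not> colourable E N W" "colourable E (Suc N) W"
    using minimal_not_colourable[OF EU(2,4) loopfree] .
  from W(3) obtain c where c: "c ` W \<subseteq> {..<Suc N}"
    "\<And>u v. (u, v) \<in> E \<Longrightarrow> u \<in> W \<Longrightarrow> v \<in> W \<Longrightarrow> c u \<noteq> c v"
    by (rule colourableE) (rule that; simp)
  define D where "D = \<lparr>pverts = W,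
    parcs = {(u, v) \<in> W \<times> W. c u < c v \<and> ((u, v) \<in> E \<or> (v, u) \<in> E)}\<rparr>"
  have finW: "finite W" using W(1) EU(2) finite_subset by blast
  have D: "pair_digraph D"
  proof
    show "finite (parcs D)"
      by (rule finite_subset[of _ "W \<times> W"]) (auto simp: D_def finW)
  qed (auto simp: D_def finW)
  have "N < chromatic_number D"
  proof (rule ccontr)
    assume "\<not> N < chromatic_number D"
    moreover
    obtain c' where c': "c' ` pverts D \<subseteq> {..<chromatic_number D}"
      "\<And>u v. (u, v) \<in> parcs D \<Longrightarrow> c' u \<noteq> c' v"
      by (rule chromatic_number_colouring[OF D]) (rule that; simp)
    ultimately have "c' ` W \<subseteq> {..<N}" by (fastforce simp: D_def)
    moreover have "c' u \<noteq> c' v" if "(u, v) \<in> E" "u \<in> W" "v \<in> W" for u v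
      using that c(2)[OF that] c'(2)[of u v] c'(2)[of v u] by (auto simp: D_def neq_iff)
    ultimately show False using W(2) unfolding colourable_def by blast
  qed
  moreover have "\<not> contains_subdivision D F" if F: "F \<in> \<C>" for F
  proof
    assume "contains_subdivision D F"
    then obtain H where H: "subgraph (with_proj H) (with_proj D)" "directed_subdivision F H"
      by (auto simp: contains_subdivision_def)
    have "oriented_cycle F" using assms(2) F by blast
    note cyc = oriented_cycle_facts[OF this]
    have HD: "pverts H \<subseteq> W" "parcs H \<subseteq> parcs D" "wf_digraph (with_proj H)"
      using H(1) by (auto simp: subgraph_def D_def)
    have Hwf: "parcs H \<subseteq> pverts H \<times> pverts H"
      using wf_digraph.tail_in_verts[OF HD(3)] wf_digraph.head_in_verts[OF HD(3)] by fastforce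
    have incr: "c x < c y \<and> c y \<le> N" if "(x, y) \<in> parcs H" for x y
      using that HD(2) c(1) by (force simp: D_def less_Suc_eq_le)
    note card = directed_subdivision_card[where c = c and N = N, OF H(2) cyc(1,3,4) incr]
    have "card (pverts F) + card (parcs F) * N \<le> L"
      using member_le_sum[OF F, of "\<lambda>F. card (pverts F) + card (parcs F) * N"] assms(1)
      by (simp add: L_def)
    then have small: "card (pverts H) \<le> L" using card(2) by simp
    have ne: "pverts H \<noteq> {}"
      using H(2) cyc(2) by (auto simp: directed_subdivision_def Let_def)
    \<comment> \<open>\<open>E\<close> is a set of ordered pairs in arbitrary directions; \<open>g\<close> takes an arc of \<open>D\<close> to a pair of \<open>E\<close>
      that it comes from.\<close>
    define g where "g = (\<lambda>(u, v). if (u, v) \<in> E then (u, v) else (v, u) :: nat \<times> nat)"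
    have "inj_on g (parcs D)" by (auto simp: inj_on_def g_def D_def split: if_splits)
    then have "inj_on g (parcs H)" using HD(2) inj_on_subset by blast
    moreover have "g ` parcs H \<subseteq> E \<inter> pverts H \<times> pverts H"
    proof
      fix e assume "e \<in> g ` parcs H"
      then obtain u v where uv: "(u, v) \<in> parcs H" "e = g (u, v)" by auto
      then have "u \<in> pverts H" "v \<in> pverts H" "(u, v) \<in> parcs D" using HD(2) Hwf by auto
      then show "e \<in> E \<inter> pverts H \<times> pverts H" using uv(2) by (auto simp: g_def D_def)
    qed
    ultimately have "card (parcs H) \<le> card (E \<inter> pverts H \<times> pverts H)"
      using EU(1) by (intro card_inj_on_le) auto
    also have "\<dots> < card (pverts H)"
      using EU(3) HD(1) W(1) ne small unfolding locally_sparse_def by blast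
    finally show False using card(1) by simp
  qed
  ultimately show ?thesis using D by blast
qed

theorem theorem8:
  fixes \<C> :: "'a pair_pre_digraph set"
  assumes "finite \<C>"
    and "\<forall>F \<in> \<C>. oriented_cycle F"
  shows "class_chromatic_number (S_Forb \<C> :: nat pair_pre_digraph set) = \<infinity> \<and>
    (\<forall>N :: nat. \<exists>D :: nat pair_pre_digraph.
       pair_digraph D \<and> N \<le> chromatic_number D \<and> (\<forall>F \<in> \<C>. \<not> contains_subdivision D F))"
proof
  note free = exists_subdivision_free[OF assms]
  have "\<not> (\<exists>k. \<forall>D \<in> (S_Forb \<C> :: nat pair_pre_digraph set). chromatic_number D \<le> k)"
    using free unfolding S_Forb_def by (auto simp: not_le)
  then show "class_chromatic_number (S_Forb \<C> :: nat pair_pre_digraph set) = \<infinity>"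
    by (simp add: class_chromatic_number_def)
  show "\<forall>N :: nat. \<exists>D :: nat pair_pre_digraph.
       pair_digraph D \<and> N \<le> chromatic_number D \<and> (\<forall>F \<in> \<C>. \<not> contains_subdivision D F)"
    using free less_imp_le by blast
qed

end
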